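(* Let $\mathbb{T}$ be the set of rooted planar binary trees, and let $D_i$ and $U'_i$ ($i\in\mathbb{N}$) be the linear operators on $K\mathbb{T}$ defined in the context. The generating functions $D(t)=\sum_{i\ge 0}D_it^i$ and $U'(t')=\sum_{i\ge 0}U'_it'^i$ satisfy the equation $$D(t)\,U'(t')=(1+tt')\,U'(t')\,D(t).$$ Equivalently, $D(t_1)\cdots D(t_n)$ and $U'(t_n)\cdots U'(t_1)$ are generalized Schur operators with $\{1,1,0,0,0,\ldots\}$.
   Context: Trees. $\mathbb{N}=\{0,1,2,\ldots\}$. Let $F$ be the monoid of words in the alphabet $\{1,2\}$, with the empty word denoted $0$, partially ordered by $v\le vw$ for $v,w\in F$ (prefix order). A (rooted planar binary) tree is a finite order ideal of $F$, i.e. a finite, possibly empty, subset $T\subset F$ closed under taking prefixes; its elements are its nodes. $\mathbb{T}$ is the set of all trees, $\mathbb{T}_i$ the set of trees with $i$ nodes, and $|T|$ is the number of nodes of $T$. The node $v1$ is the left child and $v2$ the right child of $v$. For $v\in F$ put $T_v=\{w\in T: v\le w\}$. $K$ is a field of characteristic zero (containing all formal power series in the variables used), $V_i=K\mathbb{T}_i$ (with $V_i=0$ for $i<0$), $V=K\mathbb{T}=\bigoplus_i V_i$. Up operators. $G_{U'}$ is the set of pairs $(T,T')$ of trees with $T\subset T'$ such that: if $T\ne\emptyset$, each $w\in T'\setminus T$ can be written $w=v2^n$ or $w=v12^n$ for some $v\in T$ and some integer $n\ge 0$; if $T=\emptyset$, each $w\in T'\setminus T$ is of the form $2^n$, $n\ge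 0$. $G_{U'_i}=\{(T,T')\in G_{U'}: |T|+i=|T'|\}$. The linear operator $U'_i$ is defined by $U'_iT=\sum_{T':(T,T')\in G_{U'_i}}T'$. Down operators. For a tree $T$ let $R_T=\{w\in T: w2\notin T\}$. For $w\in R_T$ let $T\circleddash w=(T\setminus T_w)\cup\{wv: w1v\in T_w\}$ (delete $w$ and move its left subtree up into its place). Let $E_T$ be the set of $w\in T$ such that whenever $w=v1w'$ with $v,w'\in F$ one has $v2\notin T$. Let $r_T=E_T\cap R_T$; it is a chain $w_{T,1}<w_{T,2}<\cdots<w_{T,k}$. For $0\le i\le |r_T|$ put $r_{T,i}=\{w_{T,1},\ldots,w_{T,i}\}$, and define $T\ominus r_{T,i}$ inductively by $T\ominus r_{T,0}=T$ and $T\ominus r_{T,i}=(T\circleddash w_{T,i})\ominus r_{T,i-1}$ for $i>0$; that is, apply $\circleddash w_{T,i}$, then $\circleddash w_{T,i-1}$, ..., finally $\circleddash w_{T,1}$. $G_{D_i}=\{(T\ominus r_{T,i},T): T\in\mathbb{T},\ |r_T|\ge i\}$. The linear operator $D_i$ is defined by: $D_iT$ is the tree $T'$ with $(T',T)\in G_{D_i}$, i.e. $D_iT=T\ominus r_{T,i}$, if $|r_T|\ge i$, and $D_iT=0$ otherwise. Generating functions and generalized Schur operators. For a sequence $\{A_i\}$, $A(x)=\sum_{i\ge0}A_ix^i$. Identities between generating functions of operators are identities of formal power series in the variables with coefficients linear operators on $V$. Given a sequence $\{a_m\}$ in $K$, one says that $D(t_1)\cdots D(t_n)$ and $U'(t_n)\cdots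 U'(t_1)$ are generalized Schur operators with $\{a_m\}$ if $U'_i,D_i$ are linear maps on $V$ with $U'_i(V_j)\subset V_{j+i}$ and $D_i(V_j)\subset V_{j-i}$ for all $i,j$, and $D(t')U'(t)=a(tt')U'(t)D(t')$. *)

theory Defs
  imports
    "HOL-Library.Sublist"
    "HOL-Library.Poly_Mapping"
    "HOL-Computational_Algebra.Formal_Power_Series"
begin

section \<open>Words and trees\<close>

datatype letter = One | Two

type_synonym word = "letter list"

typedef tree = "{T :: word set. finite T \<and> (\<forall>w\<in>T. \<forall>v. prefix v w \<longrightarrow> v \<in> T)}"
  morphisms nodes Abs_tree
  by (rule exI[of _ "{}"]) auto

setup_lifting type_definition_tree

lift_definition empty_tree :: tree is "{}" by simp

definition num_nodes :: "tree \<Rightarrow> nat" where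
  "num_nodes T = card (nodes T)"

definition subtree :: "tree \<Rightarrow> word \<Rightarrow> word set" where
  "subtree T v = {w \<in> nodes T. prefix v w}"


section \<open>The relation for the up operators\<close>

definition G_U' :: "(tree \<times> tree) set" where
  "G_U' = {(T, T'). nodes T \<subseteq> nodes T' \<and>
     (if T = empty_tree
      then \<forall>w \<in> nodes T' - nodes T. \<exists>n. w = replicate n Two
      else \<forall>w \<in> nodes T' - nodes T. \<exists>v \<in> nodes T. \<exists>n.
             w = v @ replicate n Two \<or> w = v @ [One] @ replicate n Two)}"

definition G_U'_i :: "nat \<Rightarrow> (tree \<times> tree) set" where
  "G_U'_i i = {(T, T') \<in> G_U'. num_nodes T + i = num_nodes T'}"

lemma finite_num_nodes: "finite {T. num_nodes T = n}"
proof -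
  let ?W = "{w :: word. length w \<le> n}"
  have UN: "(UNIV :: letter set) = {One, Two}"
    using letter.exhaust by auto
  have "finite {w :: word. set w \<subseteq> UNIV \<and> length w \<le> n}"
    by (rule finite_lists_length_le) (simp add: UN)
  hence fin: "finite (Pow ?W)" by simp
  have "nodes ` {T. num_nodes T = n} \<subseteq> Pow ?W"
  proof clarsimp
    fix T w assume n: "n = num_nodes T" and w: "w \<in> nodes T"
    have T: "finite (nodes T)" "\<And>v. prefix v w \<Longrightarrow> v \<in> nodes T"
      using nodes[of T] w by auto
    have "set (prefixes w) \<subseteq> nodes T"
      using T(2) by auto
    from card_mono[OF T(1) this] have "length (prefixes w) \<le> num_nodes T"
      by (simp add: num_nodes_def distinct_card)
    thus "length w \<le> num_nodes T" by simp
  qed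
  hence "finite (nodes ` {T. num_nodes T = n})"
    using fin by (rule finite_subset)
  thus ?thesis
    by (rule finite_imageD) (simp add: inj_on_def nodes_inject)
qed

lemma finite_G_U'_i: "finite {T'. (T, T') \<in> G_U'_i i}"
  by (rule finite_subset[OF _ finite_num_nodes[of "num_nodes T + i"]]) (auto simp: G_U'_i_def)


section \<open>Deleting nodes\<close>

definition R_set :: "tree \<Rightarrow> word set" where
  "R_set T = {w \<in> nodes T. w @ [Two] \<notin> nodes T}"

text \<open>Only used for \<open>w \<in> R_set T\<close>; for other \<open>w\<close> the right-hand side is still a tree.\<close>

lift_definition del_node :: "tree \<Rightarrow> word \<Rightarrow> tree" is
  "\<lambda>T w. (T - {u \<in> T. prefix w u}) \<union> {w @ v |v. w @ [One] @ v \<in> {u \<in> T. prefix w u}}"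
proof -
  fix T :: "word set" and w :: word
  assume T: "finite T \<and> (\<forall>u\<in>T. \<forall>v. prefix v u \<longrightarrow> v \<in> T)"
  let ?A = "{w @ v |v. w @ [One] @ v \<in> {u \<in> T. prefix w u}}"
  have "?A \<subseteq> (\<lambda>u. w @ drop (Suc (length w)) u) ` T"
    by (force simp: image_iff)
  hence fin: "finite ?A" using T finite_surj by blast
  have cl: "v \<in> (T - {u \<in> T. prefix w u}) \<union> ?A"
    if u: "u \<in> (T - {u \<in> T. prefix w u}) \<union> ?A" and vu: "prefix v u" for u v
    using u
  proof
    assume "u \<in> T - {u \<in> T. prefix w u}"
    thus ?thesis using T vu prefix_order.trans by blast
  next
    assume "u \<in> ?A"
    then obtain x where x: "u = w @ x" "w @ [One] @ x \<in> T" by auto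
    show ?thesis
    proof (cases "prefix w v")
      case True
      then obtain y where y: "v = w @ y" by (auto simp: prefix_def)
      hence "prefix (w @ [One] @ y) (w @ [One] @ x)" using x vu by simp
      hence "w @ [One] @ y \<in> T" using T x by blast
      thus ?thesis using y by auto
    next
      case False
      hence "prefix v w" using vu x(1) by (metis prefix_append prefixI)
      hence "prefix v (w @ [One] @ x)" by (simp add: prefix_prefix)
      thus ?thesis using T x False by blast
    qed
  qed
  show "finite ((T - {u \<in> T. prefix w u}) \<union> ?A) \<and>
        (\<forall>u\<in>(T - {u \<in> T. prefix w u}) \<union> ?A. \<forall>v. prefix v u \<longrightarrow>
           v \<in> (T - {u \<in> T. prefix w u}) \<union> ?A)"
    using T fin cl by blast
qed

lemma nodes_del_node:
  "nodes (del_node T w) = (nodes T - subtree T w) \<union> {w @ v |v. w @ [One] @ v \<in> subtree T w}"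
  unfolding subtree_def by (rule del_node.rep_eq)

definition E_set :: "tree \<Rightarrow> word set" where
  "E_set T = {w \<in> nodes T. \<forall>v w'. w = v @ [One] @ w' \<longrightarrow> v @ [Two] \<notin> nodes T}"

definition r_set :: "tree \<Rightarrow> word set" where
  "r_set T = E_set T \<inter> R_set T"

lemma r_set_chain:
  assumes "u \<in> r_set T" "w \<in> r_set T"
  shows "prefix u w \<or> prefix w u"
proof (rule ccontr)
  assume "\<not> ?thesis"
  hence "u \<parallel> w" by (simp add: parallel_def)
  then obtain v a x b y where *: "a \<noteq> b" "u = v @ a # x" "w = v @ b # y"
    using parallel_decomp by blast
  have cl: "p \<in> nodes T" if "p @ q \<in> nodes T" for p q
    using nodes[of T] that by (auto simp: prefix_def)
  have "\<forall>q z z'. \<not> (v @ One # z \<in> r_set T \<and> v @ Two # z' \<in> r_set T)"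
    using cl[of "v @ [Two]"] by (auto simp: r_set_def E_set_def R_set_def)
  thus False using * assms by (cases a; cases b) auto
qed

text \<open>The list \<open>[w\<^sub>1, \<dots>, w\<^sub>k]\<close> of the elements of the chain \<open>r_set T\<close>,
  in strictly increasing prefix order.\<close>

definition r_list :: "tree \<Rightarrow> word list" where
  "r_list T = (THE ws. sorted_wrt strict_prefix ws \<and> set ws = r_set T)"

lemma r_list_ex1: "\<exists>!ws. sorted_wrt strict_prefix ws \<and> set ws = r_set T"
proof -
  have fin: "finite (r_set T)"
    using nodes[of T] by (auto simp: r_set_def R_set_def)
  have len: "u = w" if "u \<in> r_set T" "w \<in> r_set T" "length u = length w" for u w
    using r_set_chain[OF that(1,2)] that(3) by (auto simp: prefix_def)
  have lt: "strict_prefix u w" if "u \<in> r_set T" "w \<in> r_set T" "length u < length w" for u w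
    using r_set_chain[OF that(1,2)] that(3) by (auto simp: prefix_def strict_prefix_def)
  define s where "s = sort_key length (SOME xs. set xs = r_set T \<and> distinct xs)"
  have ex: "\<exists>xs. set xs = r_set T \<and> distinct xs"
    using finite_distinct_list[OF fin] by blast
  have s: "set s = r_set T" "distinct s" "sorted (map length s)"
    using someI_ex[OF ex] by (auto simp: s_def)
  have "sorted_wrt strict_prefix s"
    unfolding sorted_wrt_iff_nth_less
  proof (intro allI impI)
    fix i j assume ij: "i < j" "j < length s"
    have m: "s ! i \<in> r_set T" "s ! j \<in> r_set T" using ij s(1) nth_mem by fastforce+
    have "length (s ! i) \<le> length (s ! j)"
      using sorted_nth_mono[OF s(3), of i j] ij by simp
    moreover have "s ! i \<noteq> s ! j" using s(2) ij by (simp add: nth_eq_iff_index_eq)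
    ultimately show "strict_prefix (s ! i) (s ! j)"
      using len[OF m] lt[OF m] by fastforce
  qed
  moreover have "ws = ws'"
    if "sorted_wrt strict_prefix ws \<and> set ws = r_set T"
       "sorted_wrt strict_prefix ws' \<and> set ws' = r_set T" for ws ws'
  proof -
    have "sorted_wrt (<) (map length ws)" "sorted_wrt (<) (map length ws')"
      using that unfolding sorted_wrt_map
      by (auto elim!: sorted_wrt_mono_rel[rotated] intro: prefix_length_less)
    moreover have "set (map length ws) = set (map length ws')" using that by simp
    ultimately have "map length ws = map length ws'"
      by (simp add: strict_sorted_equal)
    moreover have "inj_on length (set ws \<union> set ws')"
      using that len by (auto simp: inj_on_def)
    ultimately show ?thesis by (rule map_inj_on)
  qed
  ultimately show ?thesis using s(1) by blast
qed

lemma length_r_list: "length (r_list T) = card (r_set T)"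
proof -
  have *: "sorted_wrt strict_prefix (r_list T)" "set (r_list T) = r_set T"
    using theI'[OF r_list_ex1[of T]] by (auto simp: r_list_def)
  have "sorted_wrt (<) (map length (r_list T))"
    unfolding sorted_wrt_map
    by (rule sorted_wrt_mono_rel[OF _ *(1)]) (auto intro: prefix_length_less)
  hence "distinct (map length (r_list T))"
    by (simp add: strict_sorted_iff)
  hence "distinct (r_list T)" by (simp add: distinct_map)
  thus ?thesis using *(2) distinct_card by fastforce
qed

text \<open>\<open>del_chain ws i T\<close> deletes \<open>w\<^sub>i\<close>, then \<open>w\<^sub>i\<^sub>-\<^sub>1\<close>, \<dots>, finally \<open>w\<^sub>1\<close>, where
  \<open>ws = [w\<^sub>1, \<dots>, w\<^sub>k]\<close>; list indices start at 0, so \<open>w\<^sub>i\<^sub>+\<^sub>1\<close> is \<open>ws ! i\<close>.\<close>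

primrec del_chain :: "word list \<Rightarrow> nat \<Rightarrow> tree \<Rightarrow> tree" where
  "del_chain ws 0 T = T"
| "del_chain ws (Suc i) T = del_chain ws i (del_node T (ws ! i))"

definition ominus :: "tree \<Rightarrow> nat \<Rightarrow> tree" where
  "ominus T i = del_chain (r_list T) i T"


section \<open>Free vector spaces and the ring of their endomorphisms\<close>

text \<open>The type \<open>'b \<Rightarrow>\<^sub>0 'k\<close> of finitely supported functions is the \<open>'k\<close>-vector space
  with basis \<open>'b\<close>; the basis element \<open>b\<close> is \<open>Poly_Mapping.single b 1\<close>.\<close>

definition scale :: "'k::field \<Rightarrow> ('b \<Rightarrow>\<^sub>0 'k) \<Rightarrow> ('b \<Rightarrow>\<^sub>0 'k)" where
  "scale c v = Poly_Mapping.map ((*) c) v"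

lemma lookup_scale [simp]: "Poly_Mapping.lookup (scale c v) b = c * Poly_Mapping.lookup v b"
  by (simp add: scale_def Poly_Mapping.map.rep_eq when_def)

interpretation free_vs: vector_space scale
  by unfold_locales (rule poly_mapping_eqI; simp add: lookup_add algebra_simps)+

lemma linear_scale_iff:
  "Vector_Spaces.linear scale scale f \<longleftrightarrow>
     (\<forall>u v. f (u + v) = f u + f v) \<and> (\<forall>c v. f (scale c v) = scale c (f v))"
  by (simp add: Vector_Spaces.linear_iff free_vs.vector_space_axioms)

typedef (overloaded) ('b, 'k :: field) endo =
  "{f :: ('b \<Rightarrow>\<^sub>0 'k) \<Rightarrow> ('b \<Rightarrow>\<^sub>0 'k). Vector_Spaces.linear scale scale f}"
  morphisms app Abs_endo
  by (rule exI[of _ "\<lambda>v. v"]) (simp add: linear_scale_iff)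

setup_lifting type_definition_endo

instantiation endo :: (type, field) ring_1
begin

lift_definition zero_endo :: "('a, 'b) endo" is "\<lambda>_. 0"
  by (simp add: linear_scale_iff)

lift_definition one_endo :: "('a, 'b) endo" is "\<lambda>v. v"
  by (simp add: linear_scale_iff)

lift_definition plus_endo :: "('a, 'b) endo \<Rightarrow> ('a, 'b) endo \<Rightarrow> ('a, 'b) endo"
  is "\<lambda>f g v. f v + g v"
  by (simp add: linear_scale_iff free_vs.scale_right_distrib algebra_simps)

lift_definition minus_endo :: "('a, 'b) endo \<Rightarrow> ('a, 'b) endo \<Rightarrow> ('a, 'b) endo"
  is "\<lambda>f g v. f v - g v"
  by (simp add: linear_scale_iff free_vs.scale_right_diff_distrib algebra_simps)

lift_definition uminus_endo :: "('a, 'b) endo \<Rightarrow> ('a, 'b) endo" is "\<lambda>f v. - f v"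
  by (simp add: linear_scale_iff)

lift_definition times_endo :: "('a, 'b) endo \<Rightarrow> ('a, 'b) endo \<Rightarrow> ('a, 'b) endo"
  is "\<lambda>f g v. f (g v)"
  by (simp add: linear_scale_iff)

instance
proof
  show "(0 :: ('a, 'b) endo) \<noteq> 1"
  proof transfer
    have "Poly_Mapping.single undefined (1 :: 'b) \<noteq> (0 :: 'a \<Rightarrow>\<^sub>0 'b)"
      by (metis lookup_single_eq lookup_zero zero_neq_one)
    thus "(\<lambda>_ :: 'a \<Rightarrow>\<^sub>0 'b. 0 :: 'a \<Rightarrow>\<^sub>0 'b) \<noteq> (\<lambda>v. v)" by metis
  qed
qed (transfer; simp add: fun_eq_iff linear_scale_iff algebra_simps)+

end

lift_definition scalar :: "'k::field \<Rightarrow> ('b, 'k) endo" is "scale"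
  by (simp add: linear_scale_iff free_vs.scale_right_distrib mult.commute)

lift_definition lin_ext :: "('b \<Rightarrow> ('b \<Rightarrow>\<^sub>0 'k)) \<Rightarrow> ('b, 'k::field) endo" is
  "\<lambda>f v. \<Sum>b\<in>Poly_Mapping.keys v. scale (Poly_Mapping.lookup v b) (f b)"
proof -
  fix f :: "'b \<Rightarrow> ('b \<Rightarrow>\<^sub>0 'k)"
  have sup: "(\<Sum>b\<in>Poly_Mapping.keys v. scale (Poly_Mapping.lookup v b) (f b)) =
      (\<Sum>b\<in>B. scale (Poly_Mapping.lookup v b) (f b))"
    if "finite B" "Poly_Mapping.keys v \<subseteq> B" for v :: "'b \<Rightarrow>\<^sub>0 'k" and B
    by (rule sum.mono_neutral_left) (use that in \<open>auto simp: in_keys_iff\<close>)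
  show "Vector_Spaces.linear scale scale
     (\<lambda>v. \<Sum>b\<in>Poly_Mapping.keys v. scale (Poly_Mapping.lookup v b) (f b))"
    unfolding linear_scale_iff
  proof (intro conjI allI)
    fix u v :: "'b \<Rightarrow>\<^sub>0 'k"
    let ?B = "Poly_Mapping.keys u \<union> Poly_Mapping.keys v"
    show "(\<Sum>b\<in>Poly_Mapping.keys (u + v). scale (Poly_Mapping.lookup (u + v) b) (f b)) =
      (\<Sum>b\<in>Poly_Mapping.keys u. scale (Poly_Mapping.lookup u b) (f b)) +
      (\<Sum>b\<in>Poly_Mapping.keys v. scale (Poly_Mapping.lookup v b) (f b))"
      using sup[of ?B "u + v"] sup[of ?B u] sup[of ?B v] Poly_Mapping.keys_add[of u v]
      by (simp add: lookup_add free_vs.scale_left_distrib sum.distrib)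
  next
    fix c and v :: "'b \<Rightarrow>\<^sub>0 'k"
    have "Poly_Mapping.keys (scale c v) \<subseteq> Poly_Mapping.keys v"
      by (auto simp: in_keys_iff)
    thus "(\<Sum>b\<in>Poly_Mapping.keys (scale c v). scale (Poly_Mapping.lookup (scale c v) b) (f b)) =
      scale c (\<Sum>b\<in>Poly_Mapping.keys v. scale (Poly_Mapping.lookup v b) (f b))"
      using sup[of "Poly_Mapping.keys v" "scale c v"]
      by (simp add: free_vs.scale_sum_right)
  qed
qed

lemma app_lin_ext_single: "app (lin_ext f) (Poly_Mapping.single b 1) = f b"
  by (simp add: lin_ext.rep_eq)


section \<open>The operators\<close>

definition U'_op :: "nat \<Rightarrow> (tree, 'k::field_char_0) endo" where
  "U'_op i = lin_ext (\<lambda>T. \<Sum>T' | (T, T') \<in> G_U'_i i. Poly_Mapping.single T' 1)"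

definition D_op :: "nat \<Rightarrow> (tree, 'k::field_char_0) endo" where
  "D_op i = lin_ext (\<lambda>T. if i \<le> card (r_set T) then Poly_Mapping.single (ominus T i) 1 else 0)"


section \<open>Generating functions in two variables\<close>

text \<open>Formal power series in commuting variables \<open>t\<close>, \<open>t'\<close> with coefficients in \<open>'a\<close>
  are \<open>'a fps fps\<close>: \<open>t\<close> is the variable of the inner, \<open>t'\<close> that of the outer series.\<close>

definition var_t :: "'a::ring_1 fps fps" where
  "var_t = fps_const fps_X"

definition var_t' :: "'a::ring_1 fps fps" where
  "var_t' = fps_X"

definition gf_t :: "(nat \<Rightarrow> 'a::ring_1) \<Rightarrow> 'a fps fps" where
  "gf_t A = fps_const (Abs_fps A)"

definition gf_t' :: "(nat \<Rightarrow> 'a::ring_1) \<Rightarrow> 'a fps fps" where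
  "gf_t' A = Abs_fps (\<lambda>i. fps_const (A i))"

text \<open>\<open>a(tt')\<close>: the coefficient of \<open>t'\<^sup>m\<close> is \<open>a\<^sub>m t\<^sup>m\<close>.\<close>

definition gf_tt' :: "(nat \<Rightarrow> 'a::ring_1) \<Rightarrow> 'a fps fps" where
  "gf_tt' A = Abs_fps (\<lambda>m. fps_const (A m) * fps_X ^ m)"


section \<open>Generalized Schur operators\<close>

text \<open>\<open>V_i\<close> is the span of the trees with \<open>i\<close> nodes; it is zero for negative \<open>i\<close>.\<close>

definition V_comp :: "int \<Rightarrow> (tree \<Rightarrow>\<^sub>0 'k::field) set" where
  "V_comp i = free_vs.span {Poly_Mapping.single T 1 |T. int (num_nodes T) = i}"

text \<open>Linearity of the operators is part of the type \<open>endo\<close>. The definition of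
  ``\<open>D(t\<^sub>1)\<cdots>D(t\<^sub>n)\<close> and \<open>U(t\<^sub>n)\<cdots>U(t\<^sub>1)\<close> are generalized Schur operators with \<open>{a\<^sub>m}\<close>''
  is a condition on the sequences \<open>D\<close>, \<open>U\<close>, \<open>a\<close> only and does not depend on \<open>n\<close>.\<close>

definition generalized_Schur ::
  "(nat \<Rightarrow> (tree, 'k::field_char_0) endo) \<Rightarrow> (nat \<Rightarrow> (tree, 'k) endo) \<Rightarrow> (nat \<Rightarrow> 'k) \<Rightarrow> bool" where
  "generalized_Schur D U a \<longleftrightarrow>
     (\<forall>i j. app (U i) ` V_comp j \<subseteq> V_comp (j + int i)) \<and>
     (\<forall>i j. app (D i) ` V_comp j \<subseteq> V_comp (j - int i)) \<and>
     gf_t' D * gf_t U = gf_tt' (\<lambda>m. scalar (a m)) * gf_t U * gf_t' D"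

end

theory Submission
  imports Defs
begin

text \<open>
  Write \<open>N(l, r)\<close> for the tree with left and right subtrees \<open>l\<close> and \<open>r\<close>, extended bilinearly to
  \<open>V\<close>, and \<open>\<epsilon>\<close> for the coefficient of the empty tree. The operators obey the recursions
  \<open>U'(t') N(l, r) = N(U'(t') l, U'(t') r)\<close> and \<open>D(t) N(l, r) = N(l, D(t) r) + t \<epsilon>(r) D(t) l\<close>, where
  the last term comes from deleting the root, which is possible exactly when \<open>r\<close> is empty.
  Moreover \<open>\<epsilon>(U'(t') r) = \<epsilon>(r)\<close>. Hence
  \<open>D(t) U'(t') N(l, r) = N(U'(t') l, D(t) U'(t') r) + t \<epsilon>(r) D(t) U'(t') l\<close>, and the factor
  \<open>1 + t t'\<close> is pulled out by induction. For the empty tree, \<open>U'(t')\<close> gives the sum of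
  \<open>t'\<^sup>n c\<^sub>n\<close> over the right chains \<open>c\<^sub>n\<close>, and \<open>D(t) c\<^sub>n = c\<^sub>n + t c\<^sub>n\<^sub>-\<^sub>1\<close> for \<open>n > 0\<close>.
\<close>

section \<open>Trees as nodes with two subtrees\<close>

lift_definition node :: "tree \<Rightarrow> tree \<Rightarrow> tree"
  is "\<lambda>l r. insert [] ((#) One ` l \<union> (#) Two ` r)"
  by (auto simp: prefix_Cons)

lemma nodes_empty_tree [simp]: "nodes empty_tree = {}"
  by (rule empty_tree.rep_eq)

lemma nodes_node [simp]:
  "[] \<in> nodes (node l r)"
  "One # w \<in> nodes (node l r) \<longleftrightarrow> w \<in> nodes l"
  "Two # w \<in> nodes (node l r) \<longleftrightarrow> w \<in> nodes r"
  by (auto simp: node.rep_eq)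

lemma finite_nodes [simp]: "finite (nodes T)"
  using nodes[of T] by auto

lemma nodes_prefix: "w \<in> nodes T \<Longrightarrow> prefix v w \<Longrightarrow> v \<in> nodes T"
  using nodes[of T] by auto

lemma tree_eqI: "(\<And>w. w \<in> nodes T \<longleftrightarrow> w \<in> nodes T') \<Longrightarrow> T = T'"
  by (metis nodes_inject set_eqI)

lemma word_cases:
  obtains "w = []" | v where "w = One # v" | v where "w = Two # v"
  by (metis letter.exhaust list.exhaust)

lemma node_eqI:
  assumes "[] \<in> nodes T" "\<And>w. One # w \<in> nodes T \<longleftrightarrow> w \<in> nodes l"
    "\<And>w. Two # w \<in> nodes T \<longleftrightarrow> w \<in> nodes r"
  shows "T = node l r"
proof (rule tree_eqI)
  fix w show "w \<in> nodes T \<longleftrightarrow> w \<in> nodes (node l r)"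
    by (cases w rule: word_cases) (simp_all add: assms)
qed

lemma node_neq_empty_tree [simp]: "node l r \<noteq> empty_tree" "empty_tree \<noteq> node l r"
  by (metis empty_iff nodes_empty_tree nodes_node(1))+

lemma node_inject [simp]: "node l r = node l' r' \<longleftrightarrow> l = l' \<and> r = r'"
  by (metis nodes_node(2,3) tree_eqI)

lemma Nil_in_nodes_iff [simp]: "[] \<in> nodes T \<longleftrightarrow> T \<noteq> empty_tree"
proof
  assume "T \<noteq> empty_tree"
  then obtain w where "w \<in> nodes T" by (metis nodes_empty_tree all_not_in_conv nodes_inject)
  thus "[] \<in> nodes T" by (rule nodes_prefix) simp
qed auto

text \<open>The subtrees are the preimages of \<open>nodes T\<close> under prepending a letter;
  these are prefix-closed because prepending a common letter preserves prefixes.\<close>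

lemma tree_cases [cases type: tree]:
  obtains "T = empty_tree" | l r where "T = node l r"
proof (cases "T = empty_tree")
  case False
  have sub: "finite ((#) a -` nodes T)" for a
    by (rule finite_vimageI) simp_all
  define S where "S a = Abs_tree ((#) a -` nodes T)" for a
  have "nodes (S a) = (#) a -` nodes T" for a
    unfolding S_def by (rule Abs_tree_inverse) (auto simp: sub intro: nodes_prefix)
  hence "T = node (S One) (S Two)"
    using False by (intro node_eqI) simp_all
  thus ?thesis using that by blast
qed (use that in blast)

section \<open>Node count and structural induction\<close>

lemma num_nodes_empty_tree [simp]: "num_nodes empty_tree = 0"
  by (simp add: num_nodes_def)

lemma num_nodes_node [simp]: "num_nodes (node l r) = Suc (num_nodes l + num_nodes r)"
proof -
  have "card ((#) One ` nodes l \<union> (#) Two ` nodes r) = num_nodes l + num_nodes r"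
    unfolding num_nodes_def by (subst card_Un_disjoint) (auto simp: card_image)
  thus ?thesis
    unfolding num_nodes_def node.rep_eq by (subst card_insert_disjoint) auto
qed

lemma tree_induct [case_names empty node, induct type: tree]:
  assumes "P empty_tree" "\<And>l r. P l \<Longrightarrow> P r \<Longrightarrow> P (node l r)"
  shows "P T"
proof (induction "num_nodes T" arbitrary: T rule: less_induct)
  case less
  show ?case by (cases T) (use less assms in auto)
qed


section \<open>The up relation\<close>

definition addable :: "tree \<Rightarrow> word \<Rightarrow> bool" where
  "addable T w \<longleftrightarrow> (if T = empty_tree then \<exists>n. w = replicate n Two
     else \<exists>v\<in>nodes T. \<exists>n. w = v @ replicate n Two \<or> w = v @ [One] @ replicate n Two)"

lemma G_U'_iff:
  "(T, T') \<in> G_U' \<longleftrightarrow> nodes T \<subseteq> nodes T' \<and> (\<forall>w\<in>nodes T' - nodes T. addable T w)"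
  by (auto simp: G_U'_def addable_def)

lemma Two_Cons_replicate: "Two # w = replicate n Two \<longleftrightarrow> (\<exists>m. n = Suc m \<and> w = replicate m Two)"
  by (cases n) auto

lemma One_Cons_replicate [simp]: "One # w \<noteq> replicate n Two"
  by (cases n) auto

lemma bex_nodes_node:
  "(\<exists>v\<in>nodes (node l r). P v) \<longleftrightarrow>
     P [] \<or> (\<exists>v\<in>nodes l. P (One # v)) \<or> (\<exists>v\<in>nodes r. P (Two # v))"
  by (auto simp: node.rep_eq)

text \<open>Only the subtree that a word enters matters. The special clause for an empty tree makes
  this uniform: the right chains it admits are those that the root of \<open>node l r\<close>
  supplies.\<close>

lemma addable_node [simp]:
  "addable (node l r) (One # w) \<longleftrightarrow> addable l w"
  "addable (node l r) (Two # w) \<longleftrightarrow> addable r w"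
proof -
  \<comment> \<open>Right chains hanging from the parent add nothing to a nonempty subtree: its own
    root, the empty word, supplies the same words.\<close>
  have *: "\<exists>v\<in>nodes T. \<exists>n. replicate m Two = v @ replicate n Two \<or>
      replicate m Two = v @ One # replicate n Two" if "T \<noteq> empty_tree" for T m
    by (rule bexI[of _ "[]"]) (use that in auto)
  show "addable (node l r) (One # w) \<longleftrightarrow> addable l w"
    unfolding addable_def bex_nodes_node by (auto simp: *)
  show "addable (node l r) (Two # w) \<longleftrightarrow> addable r w"
    unfolding addable_def bex_nodes_node by (auto simp: * Two_Cons_replicate)
qed

lemma all_words: "(\<forall>w. P w) \<longleftrightarrow> P [] \<and> (\<forall>w. P (One # w)) \<and> (\<forall>w. P (Two # w))"
  by (metis word_cases)

lemma G_U'_node_node [simp]: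
  "(node l r, node l' r') \<in> G_U' \<longleftrightarrow> (l, l') \<in> G_U' \<and> (r, r') \<in> G_U'"
  unfolding G_U'_iff subset_iff Ball_def Diff_iff
  by (subst (1 2) all_words) auto

lemma G_U'_empty_node [simp]:
  "(empty_tree, node l r) \<in> G_U' \<longleftrightarrow> l = empty_tree \<and> (empty_tree, r) \<in> G_U'"
proof -
  have "(empty_tree, node l r) \<in> G_U' \<longleftrightarrow>
      nodes l = {} \<and> (\<forall>w\<in>nodes r. addable empty_tree w)"
    unfolding G_U'_iff Ball_def Diff_iff
    by (subst all_words) (auto simp: addable_def Two_Cons_replicate)
  thus ?thesis
    by (metis Diff_empty G_U'_iff empty_subsetI nodes_empty_tree nodes_inject)
qed

lemma G_U'_empty_right [simp]: "(T, empty_tree) \<in> G_U' \<longleftrightarrow> T = empty_tree"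
  using Nil_in_nodes_iff[of T] by (auto simp: G_U'_iff simp del: Nil_in_nodes_iff)

lemma G_U'_num_nodes_le: "(T, T') \<in> G_U' \<Longrightarrow> num_nodes T \<le> num_nodes T'"
  by (auto simp: G_U'_iff num_nodes_def intro: card_mono)

section \<open>Trees above a given tree, by number of added nodes\<close>

lemma G_U'_i_empty_0: "{T'. (empty_tree, T') \<in> G_U'_i 0} = {empty_tree}"
proof -
  have "(empty_tree, T') \<in> G_U'_i 0 \<longleftrightarrow> T' = empty_tree" for T'
    by (cases T') (auto simp: G_U'_i_def)
  thus ?thesis by blast
qed

lemma G_U'_i_empty_Suc:
  "{T'. (empty_tree, T') \<in> G_U'_i (Suc n)} = node empty_tree ` {T'. (empty_tree, T') \<in> G_U'_i n}"
proof -
  have "(empty_tree, T') \<in> G_U'_i (Suc n) \<longleftrightarrow>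
      T' \<in> node empty_tree ` {T'. (empty_tree, T') \<in> G_U'_i n}" for T'
    by (cases T') (auto simp: G_U'_i_def)
  thus ?thesis by blast
qed

lemma bij_betw_G_U'_i_node:
  "bij_betw (\<lambda>(i, l', r'). node l' r')
     (SIGMA i:{..n}. {l'. (l, l') \<in> G_U'_i i} \<times> {r'. (r, r') \<in> G_U'_i (n - i)})
     {T'. (node l r, T') \<in> G_U'_i n}"
proof -
  have surj: "\<exists>i l' r'. i \<le> n \<and> T' = node l' r' \<and> (l, l') \<in> G_U'_i i \<and> (r, r') \<in> G_U'_i (n - i)"
    if "(node l r, T') \<in> G_U'_i n" for T'
  proof (cases T')
    case (2 l' r')
    with that have *: "(l, l') \<in> G_U'" "(r, r') \<in> G_U'"
      "num_nodes l + num_nodes r + n = num_nodes l' + num_nodes r'"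
      by (auto simp: G_U'_i_def)
    \<comment> \<open>The left subtree receives \<open>num_nodes l' - num_nodes l\<close> of the new
      nodes; monotonicity of the node count makes this natural subtraction exact.\<close>
    show ?thesis
      using * G_U'_num_nodes_le[OF *(1)] G_U'_num_nodes_le[OF *(2)] 2
      by (intro exI[of _ "num_nodes l' - num_nodes l"] exI[of _ l'] exI[of _ r'])
        (auto simp: G_U'_i_def)
  qed (use that in \<open>auto simp: G_U'_i_def\<close>)
  show ?thesis
    unfolding bij_betw_def
  proof
    show "inj_on (\<lambda>(i, l', r'). node l' r')
      (SIGMA i:{..n}. {l'. (l, l') \<in> G_U'_i i} \<times> {r'. (r, r') \<in> G_U'_i (n - i)})"
      by (auto simp: inj_on_def G_U'_i_def)
    show "(\<lambda>(i, l', r'). node l' r') `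
      (SIGMA i:{..n}. {l'. (l, l') \<in> G_U'_i i} \<times> {r'. (r, r') \<in> G_U'_i (n - i)})
      = {T'. (node l r, T') \<in> G_U'_i n}"
      using surj by (fastforce simp: G_U'_i_def image_iff)
  qed
qed


section \<open>Deletion\<close>

lemma mem_del_node:
  "u \<in> nodes (del_node T w) \<longleftrightarrow>
     u \<in> nodes T \<and> \<not> prefix w u \<or> (\<exists>v. u = w @ v \<and> w @ One # v \<in> nodes T)"
  by (auto simp: nodes_del_node subtree_def)

lemma del_node_Nil [simp]: "del_node (node l r) [] = l"
  by (rule tree_eqI) (auto simp: mem_del_node)

lemma del_node_One [simp]: "del_node (node l r) (One # w) = node (del_node l w) r"
  by (rule node_eqI) (auto simp: mem_del_node simp del: Nil_in_nodes_iff)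

lemma del_node_Two [simp]: "del_node (node l r) (Two # w) = node l (del_node r w)"
  by (rule node_eqI) (auto simp: mem_del_node simp del: Nil_in_nodes_iff)

section \<open>The chain of deletable nodes and its deletion, by subtrees\<close>

lemma r_list_props: "sorted_wrt strict_prefix (r_list T)" "set (r_list T) = r_set T"
  using theI'[OF r_list_ex1[of T]] by (auto simp: r_list_def)

lemma r_list_eqI: "sorted_wrt strict_prefix ws \<Longrightarrow> set ws = r_set T \<Longrightarrow> r_list T = ws"
  using r_list_ex1[of T] r_list_props[of T] by blast

lemma mem_r_set:
  "w \<in> r_set T \<longleftrightarrow> w \<in> nodes T \<and> w @ [Two] \<notin> nodes T \<and>
     (\<forall>v w'. w = v @ One # w' \<longrightarrow> v @ [Two] \<notin> nodes T)"
  by (auto simp: r_set_def R_set_def E_set_def)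

text \<open>At the root (\<open>v = []\<close>) the condition of \<open>E_set\<close> concerns only
  words beginning with \<open>One\<close>, and excludes them unless \<open>r\<close> is empty; at
  other prefixes it is the condition of the subtree.\<close>

lemma mem_r_set_node:
  "[] \<in> r_set (node l r) \<longleftrightarrow> r = empty_tree"
  "One # w \<in> r_set (node l r) \<longleftrightarrow> r = empty_tree \<and> w \<in> r_set l"
  "Two # w \<in> r_set (node l r) \<longleftrightarrow> w \<in> r_set r"
proof -
  show "[] \<in> r_set (node l r) \<longleftrightarrow> r = empty_tree"
    by (auto simp: mem_r_set)
  show "One # w \<in> r_set (node l r) \<longleftrightarrow> r = empty_tree \<and> w \<in> r_set l"
    unfolding mem_r_set by (subst all_words) auto
  show "Two # w \<in> r_set (node l r) \<longleftrightarrow> w \<in> r_set r"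
    unfolding mem_r_set by (subst all_words) auto
qed

lemma r_set_empty_tree [simp]: "r_set empty_tree = {}"
  by (auto simp: mem_r_set)

lemma r_set_node:
  "r_set (node l r) =
     (if r = empty_tree then insert [] ((#) One ` r_set l) else (#) Two ` r_set r)"
proof (rule set_eqI)
  fix w show "w \<in> r_set (node l r) \<longleftrightarrow>
     w \<in> (if r = empty_tree then insert [] ((#) One ` r_set l) else (#) Two ` r_set r)"
    by (cases w rule: word_cases) (auto simp: mem_r_set_node)
qed

lemma r_list_node_empty: "r_list (node l empty_tree) = [] # map ((#) One) (r_list l)"
  using r_list_props[of l]
  by (intro r_list_eqI) (auto simp: sorted_wrt_map r_set_node)

lemma r_list_node: "r \<noteq> empty_tree \<Longrightarrow> r_list (node l r) = map ((#) Two) (r_list r)"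
  using r_list_props[of r]
  by (intro r_list_eqI) (auto simp: sorted_wrt_map r_set_node)

lemma card_r_set_node_empty: "card (r_set (node l empty_tree)) = Suc (card (r_set l))"
  by (simp add: length_r_list[symmetric] r_list_node_empty)

lemma card_r_set_node: "r \<noteq> empty_tree \<Longrightarrow> card (r_set (node l r)) = card (r_set r)"
  by (simp add: length_r_list[symmetric] r_list_node)

text \<open>Indices are consumed downwards, so the head of the list is deleted last. For a tree with
  empty right subtree that head is the root.\<close>

lemma del_chain_Cons: "del_chain (w # ws) (Suc i) T = del_node (del_chain ws i T) w"
  by (induction i arbitrary: T) auto

lemma del_chain_One:
  "i \<le> length ws \<Longrightarrow> del_chain (map ((#) One) ws) i (node l r) = node (del_chain ws i l) r"
  by (induction i arbitrary: l) auto

lemma del_chain_Two: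
  "i \<le> length ws \<Longrightarrow> del_chain (map ((#) Two) ws) i (node l r) = node l (del_chain ws i r)"
  by (induction i arbitrary: r) auto

lemma ominus_0 [simp]: "ominus T 0 = T"
  by (simp add: ominus_def)

text \<open>The deletions in the left subtree come first; then the root goes and what is left of
  that subtree takes its place. \<open>Suc i\<close> counts the root.\<close>

lemma ominus_node_empty:
  "i \<le> card (r_set l) \<Longrightarrow> ominus (node l empty_tree) (Suc i) = ominus l i"
  by (simp only: ominus_def r_list_node_empty del_chain_Cons del_chain_One length_r_list del_node_Nil)

lemma ominus_node:
  "r \<noteq> empty_tree \<Longrightarrow> i \<le> card (r_set r) \<Longrightarrow> ominus (node l r) i = node l (ominus r i)"
  by (simp add: ominus_def r_list_node del_chain_Two length_r_list)

lemma num_nodes_ominus: "i \<le> card (r_set T) \<Longrightarrow> num_nodes (ominus T i) + i = num_nodes T"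
proof (induction T arbitrary: i)
  case (node l r)
  show ?case
  proof (cases "r = empty_tree")
    case True
    with node show ?thesis
      by (cases i) (force simp: ominus_node_empty card_r_set_node_empty)+
  next
    case False
    with node show ?thesis by (simp add: ominus_node card_r_set_node)
  qed
qed auto


section \<open>Linear extensions\<close>

lemma app_add: "app f (u + v) = app f u + app f v"
  and app_scale: "app f (scale c v) = scale c (app f v)"
  using app[of f] by (simp_all add: linear_scale_iff)

lemma app_0 [simp]: "app f 0 = 0"
  using app_add[of f 0 0] by simp

lemma app_sum: "app f (\<Sum>i\<in>I. g i) = (\<Sum>i\<in>I. app f (g i))"
  by (induction I rule: infinite_finite_induct) (simp_all add: app_add)

lemma app_zero [simp]: "app 0 v = 0"
  by (simp add: zero_endo.rep_eq)

text \<open>Each vector is a finite combination of basis vectors, so linear identities can be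
  checked on the basis.\<close>

lemma basis_induct [case_names add scale basis]:
  fixes v :: "'b \<Rightarrow>\<^sub>0 'k::field"
  assumes "\<And>u v. P u \<Longrightarrow> P v \<Longrightarrow> P (u + v)" "\<And>c v. P v \<Longrightarrow> P (scale c v)"
    "\<And>b. P (Poly_Mapping.single b 1)"
  shows "P v"
proof -
  have P_0: "P 0"
    using assms(2)[OF assms(3), of 0 undefined] by simp
  have "P (\<Sum>b\<in>B. scale (c b) (Poly_Mapping.single b 1))" for B c
    by (induction B rule: infinite_finite_induct) (simp_all add: P_0 assms)
  moreover have "v = (\<Sum>b\<in>Poly_Mapping.keys v. scale (Poly_Mapping.lookup v b) (Poly_Mapping.single b 1))"
  proof (rule poly_mapping_eqI)
    fix b
    show "Poly_Mapping.lookup v b = Poly_Mapping.lookup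
        (\<Sum>b\<in>Poly_Mapping.keys v. scale (Poly_Mapping.lookup v b) (Poly_Mapping.single b 1)) b"
      by (simp add: lookup_sum lookup_single when_def in_keys_iff if_distrib cong: if_cong)
  qed
  ultimately show ?thesis by metis
qed

text \<open>The bilinear extension \<open>N\<close> of \<open>node\<close>. Linearity in
  \<open>x\<close> is immediate from the outer extension; linearity in \<open>y\<close> is read off
  from the expansion over the support of \<open>x\<close>.\<close>

definition nodeV :: "(tree \<Rightarrow>\<^sub>0 'k) \<Rightarrow> (tree \<Rightarrow>\<^sub>0 'k) \<Rightarrow> (tree \<Rightarrow>\<^sub>0 'k::field)" where
  "nodeV x y = app (lin_ext (\<lambda>l. app (lin_ext (\<lambda>r. Poly_Mapping.single (node l r) 1)) y)) x"

lemma nodeV_basis [simp]: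
  "nodeV (Poly_Mapping.single l 1) (Poly_Mapping.single r 1) = Poly_Mapping.single (node l r) 1"
  by (simp add: nodeV_def app_lin_ext_single)

lemma nodeV_add_left: "nodeV (x + x') y = nodeV x y + nodeV x' y"
  and nodeV_scale_left: "nodeV (scale c x) y = scale c (nodeV x y)"
  and nodeV_sum_left: "nodeV (\<Sum>i\<in>I. f i) y = (\<Sum>i\<in>I. nodeV (f i) y)"
  by (simp_all add: nodeV_def app_add app_scale app_sum)

lemma nodeV_eq_sum:
  "nodeV x y = (\<Sum>l\<in>Poly_Mapping.keys x. scale (Poly_Mapping.lookup x l)
     (app (lin_ext (\<lambda>r. Poly_Mapping.single (node l r) 1)) y))"
  unfolding nodeV_def by (subst lin_ext.rep_eq) (rule refl)

lemma nodeV_add_right: "nodeV x (y + y') = nodeV x y + nodeV x y'"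
  and nodeV_scale_right: "nodeV x (scale c y) = scale c (nodeV x y)"
  by (simp_all add: nodeV_eq_sum app_add app_scale free_vs.scale_right_distrib sum.distrib
      free_vs.scale_sum_right mult.commute)

lemma nodeV_0_right [simp]: "nodeV x 0 = 0"
  using nodeV_add_right[of x 0 0] by simp

lemma nodeV_sum_right: "nodeV x (\<Sum>i\<in>I. f i) = (\<Sum>i\<in>I. nodeV x (f i))"
  by (induction I rule: infinite_finite_induct) (simp_all add: nodeV_add_right)


section \<open>The operators on trees with given subtrees\<close>

text \<open>The coefficients of \<open>x A(x)\<close>: a factor \<open>t t'\<close> becomes one
  \<open>shift\<close> in each index.\<close>

definition shift :: "(nat \<Rightarrow> 'a::zero) \<Rightarrow> nat \<Rightarrow> 'a" where
  "shift A n = (case n of 0 \<Rightarrow> 0 | Suc m \<Rightarrow> A m)"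

lemma shift_simps [simp]: "shift A 0 = 0" "shift A (Suc n) = A n"
  by (simp_all add: shift_def)

lemma U'_op_basis:
  "app (U'_op n) (Poly_Mapping.single T 1) = (\<Sum>T' | (T, T') \<in> G_U'_i n. Poly_Mapping.single T' 1)"
  by (simp add: U'_op_def app_lin_ext_single)

lemma D_op_basis:
  "app (D_op m) (Poly_Mapping.single T 1) =
     (if m \<le> card (r_set T) then Poly_Mapping.single (ominus T m) 1 else 0)"
  by (simp add: D_op_def app_lin_ext_single)

lemma U'_op_empty_0:
  "app (U'_op 0) (Poly_Mapping.single empty_tree 1) = Poly_Mapping.single empty_tree 1"
  by (simp add: U'_op_basis G_U'_i_empty_0)

lemma U'_op_empty_Suc:
  "app (U'_op (Suc n)) (Poly_Mapping.single empty_tree 1) =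
     nodeV (Poly_Mapping.single empty_tree 1) (app (U'_op n) (Poly_Mapping.single empty_tree 1))"
  unfolding U'_op_basis G_U'_i_empty_Suc
  by (subst sum.reindex) (auto simp: inj_on_def nodeV_sum_right)

text \<open>The coefficient of \<open>t'^n\<close> in \<open>U' N(x, y) = N(U' x, U' y)\<close>: the
  added nodes are distributed over the two subtrees.\<close>

lemma U'_op_nodeV:
  "app (U'_op n) (nodeV x y) = (\<Sum>i\<le>n. nodeV (app (U'_op i) x) (app (U'_op (n - i)) y))"
proof (induction x rule: basis_induct)
  case (basis l)
  show ?case
  proof (induction y rule: basis_induct)
    case (basis r)
    have "app (U'_op n) (nodeV (Poly_Mapping.single l 1) (Poly_Mapping.single r 1)) =
        (\<Sum>(i, l', r')\<in>(SIGMA i:{..n}. {l'. (l, l') \<in> G_U'_i i} \<times> {r'. (r, r') \<in> G_U'_i (n - i)}).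
          Poly_Mapping.single (node l' r') 1)"
      unfolding nodeV_basis U'_op_basis
      by (subst sum.reindex_bij_betw[OF bij_betw_G_U'_i_node, symmetric])
        (simp add: case_prod_unfold)
    also have "\<dots> = (\<Sum>i\<le>n. \<Sum>l' | (l, l') \<in> G_U'_i i. \<Sum>r' | (r, r') \<in> G_U'_i (n - i).
        Poly_Mapping.single (node l' r') 1)"
      by (simp add: sum.Sigma sum.cartesian_product finite_G_U'_i)
    finally show ?case
      unfolding U'_op_basis nodeV_sum_left by (simp add: nodeV_sum_right)
  qed (simp_all add: nodeV_add_right nodeV_scale_right app_add app_scale sum.distrib
      free_vs.scale_sum_right)
qed (simp_all add: nodeV_add_left nodeV_scale_left app_add app_scale sum.distrib
    free_vs.scale_sum_right)

lemma lookup_U'_op_empty_tree: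
  "Poly_Mapping.lookup (app (U'_op n) y) empty_tree =
     (if n = 0 then Poly_Mapping.lookup y empty_tree else 0)"
proof (induction y rule: basis_induct)
  case (basis r)
  have "(r, empty_tree) \<in> G_U'_i n \<longleftrightarrow> r = empty_tree \<and> n = 0"
    by (auto simp: G_U'_i_def)
  thus ?case
    by (auto simp: U'_op_basis lookup_sum lookup_single when_def finite_G_U'_i)
qed (auto simp: app_add app_scale lookup_add)

lemma D_op_0 [simp]: "app (D_op 0) x = x"
  by (induction x rule: basis_induct) (simp_all add: D_op_basis app_add app_scale)

lemma D_op_Suc_empty [simp]: "app (D_op (Suc m)) (Poly_Mapping.single empty_tree 1) = 0"
  by (simp add: D_op_basis)

text \<open>The lookup is \<epsilon>\<open>(y)\<close>. On basis trees with empty \<open>r\<close>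
  and \<open>m > 0\<close> the first term vanishes and the second records the deletion of the root;
  for nonempty \<open>r\<close> only the first survives.\<close>

lemma D_op_nodeV:
  "app (D_op m) (nodeV x y) =
     nodeV x (app (D_op m) y) + scale (Poly_Mapping.lookup y empty_tree) (app (shift D_op m) x)"
proof (induction x rule: basis_induct)
  case (basis l)
  show ?case
  proof (induction y rule: basis_induct)
    case (basis r)
    show ?case
    proof (cases "r = empty_tree")
      case True
      thus ?thesis
        by (cases m) (auto simp: D_op_basis[of _ "node _ _"] D_op_basis[of _ l]
            card_r_set_node_empty ominus_node_empty)
    next
      case False
      thus ?thesis
        by (simp add: D_op_basis card_r_set_node ominus_node lookup_single)
    qed
  qed (simp_all add: nodeV_add_right nodeV_scale_right app_add app_scale
      free_vs.scale_right_distrib free_vs.scale_left_distrib lookup_add)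
qed (simp_all add: nodeV_add_left nodeV_scale_left app_add app_scale
    free_vs.scale_right_distrib mult.commute)


section \<open>The commutation relation\<close>

lemma D_op_U'_op_empty:
  "app (D_op m) (app (U'_op n) (Poly_Mapping.single empty_tree 1)) =
     app (U'_op n) (app (D_op m) (Poly_Mapping.single empty_tree 1)) +
     app (shift U'_op n) (app (shift D_op m) (Poly_Mapping.single empty_tree 1))"
proof (induction n)
  case 0
  show ?case by (cases m) (simp_all add: U'_op_empty_0)
next
  case (Suc n)
  show ?case
  proof (cases m)
    case m: (Suc k)
    let ?o = "Poly_Mapping.single empty_tree (1 :: 'a)"
    \<comment> \<open>The right chain with \<open>n + 1\<close> nodes is \<open>N\<close> of the
      empty tree and the chain with \<open>n\<close> nodes, to which the induction hypothesis
      applies. \<open>D_op (Suc k)\<close> kills the empty tree, so only the shifted term remains;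
      the scalar is \<epsilon> of the shorter chain.\<close>
    have "app (D_op m) (app (U'_op (Suc n)) ?o) =
        nodeV ?o (app (shift U'_op n) (app (D_op k) ?o)) +
        scale (if n = 0 then 1 else 0) (app (D_op k) ?o)"
      by (simp add: m U'_op_empty_Suc D_op_nodeV Suc.IH[unfolded m] lookup_U'_op_empty_tree)
    also have "\<dots> = app (U'_op n) (app (D_op k) ?o)"
      by (cases k; cases n) (simp_all add: U'_op_empty_0 U'_op_empty_Suc)
    finally show ?thesis by (simp add: m)
  qed simp
qed

lemma D_op_U'_op_basis:
  "app (D_op m) (app (U'_op n) (Poly_Mapping.single T 1)) =
     app (U'_op n) (app (D_op m) (Poly_Mapping.single T 1)) +
     app (shift U'_op n) (app (shift D_op m) (Poly_Mapping.single T 1))"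
proof (induction T arbitrary: m n)
  case empty
  show ?case by (rule D_op_U'_op_empty)
next
  case (node l r)
  let ?l = "Poly_Mapping.single l (1 :: 'a)" and ?r = "Poly_Mapping.single r (1 :: 'a)"
  let ?e = "Poly_Mapping.lookup ?r empty_tree"
  let ?A = "\<Sum>i\<le>n. nodeV (app (U'_op i) ?l) (app (U'_op (n - i)) (app (D_op m) ?r))"
  let ?B = "\<Sum>i\<le>n. nodeV (app (U'_op i) ?l) (app (shift U'_op (n - i)) (app (shift D_op m) ?r))"
  \<comment> \<open>The induction hypothesis for the left subtree at index \<open>m - 1\<close>,
    since deleting the root uses up one unit of \<open>m\<close>.\<close>
  have shift_l: "app (shift D_op m) (app (U'_op n) ?l) = app (U'_op n) (app (shift D_op m) ?l) +
      app (shift U'_op n) (app (shift (shift D_op) m) ?l)"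
    by (cases m) (simp_all add: node.IH)
  have B: "app (shift U'_op n) (app (shift D_op m) (nodeV ?l ?r)) =
      ?B + scale ?e (app (shift U'_op n) (app (shift (shift D_op) m) ?l))"
  proof (cases m; cases n)
    fix k j assume [simp]: "m = Suc k" "n = Suc j"
    \<comment> \<open>The summand \<open>i = n\<close> drops out because
      \<open>shift U'_op 0 = 0\<close>.\<close>
    have "?B = (\<Sum>i\<le>j. nodeV (app (U'_op i) ?l) (app (U'_op (j - i)) (app (D_op k) ?r)))"
      by (simp add: Suc_diff_le)
    thus ?thesis by (simp add: D_op_nodeV app_add app_scale U'_op_nodeV del: nodeV_basis)
  qed simp_all
  have "app (D_op m) (app (U'_op n) (nodeV ?l ?r)) =
      (\<Sum>i\<le>n. nodeV (app (U'_op i) ?l) (app (D_op m) (app (U'_op (n - i)) ?r))) +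
      (\<Sum>i\<le>n. scale (if n = i then ?e else 0) (app (shift D_op m) (app (U'_op i) ?l)))"
    by (simp add: U'_op_nodeV app_sum D_op_nodeV sum.distrib lookup_U'_op_empty_tree
        del: nodeV_basis cong: if_cong)
  \<comment> \<open>The induction hypothesis for \<open>r\<close> splits the first sum into
    \<open>?A\<close> and \<open>?B\<close>; in the second only \<open>i = n\<close>, where nothing
    is added on the right, survives.\<close>
  also have "\<dots> = ?A + ?B + scale ?e (app (shift D_op m) (app (U'_op n) ?l))"
    by (simp add: node.IH nodeV_add_right sum.distrib if_distrib[of "\<lambda>c. scale c _"] cong: if_cong)
  also have "\<dots> = app (U'_op n) (app (D_op m) (nodeV ?l ?r)) +
      app (shift U'_op n) (app (shift D_op m) (nodeV ?l ?r))"
    unfolding B shift_l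
    by (simp add: D_op_nodeV app_add app_scale U'_op_nodeV free_vs.scale_right_distrib algebra_simps
        del: nodeV_basis)
  finally show ?case by simp
qed

lemma D_op_U'_op:
  "(D_op m :: (tree, 'a::field_char_0) endo) * U'_op n = U'_op n * D_op m + shift U'_op n * shift D_op m"
proof -
  have "app (D_op m * U'_op n) x = app (U'_op n * D_op m + shift U'_op n * shift D_op m) x"
    for x :: "tree \<Rightarrow>\<^sub>0 'a"
    unfolding times_endo.rep_eq plus_endo.rep_eq
    by (induction x rule: basis_induct)
      (simp_all add: D_op_U'_op_basis app_add app_scale free_vs.scale_right_distrib)
  thus ?thesis by (simp add: app_inject[symmetric] fun_eq_iff)
qed


section \<open>Generating functions\<close>

text \<open>The outer index \<open>n\<close> is the exponent of \<open>t'\<close>, the inner index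
  \<open>m\<close> that of \<open>t\<close>; each variable lowers its own exponent by one.\<close>

lemma fps_nth_var_t_var_t'_mult:
  "fps_nth (fps_nth (var_t * var_t' * F) n) m = shift (\<lambda>n. shift (\<lambda>m. fps_nth (fps_nth F n) m) m) n"
  by (cases n; cases m) (simp_all add: var_t_def var_t'_def mult.assoc)

lemma one_plus_var_t_var_t'_mult:
  "(1 + var_t * var_t') * F * G = F * G + var_t * var_t' * (F * G)"
  by (simp add: distrib_right mult.assoc)

text \<open>The factors involve different variables, so the Cauchy product has a single term; the
  coefficients do not commute and keep their order.\<close>

lemma fps_nth_gf_t_gf_t': "fps_nth (fps_nth (gf_t A * gf_t' B) n) m = A m * B n"
  by (simp add: gf_t_def gf_t'_def)

lemma fps_nth_gf_t'_gf_t: "fps_nth (fps_nth (gf_t' B * gf_t A) n) m = B n * A m"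
  by (simp add: gf_t_def gf_t'_def)

lemma scalar_0 [simp]: "scalar 0 = 0"
  by (simp add: app_inject[symmetric] scalar.rep_eq zero_endo.rep_eq fun_eq_iff)

lemma scalar_1 [simp]: "scalar 1 = 1"
  by (simp add: app_inject[symmetric] scalar.rep_eq one_endo.rep_eq fun_eq_iff)

lemma gf_tt'_scalar:
  "gf_tt' (\<lambda>m. scalar (if m \<le> 1 then 1 else 0)) = 1 + var_t * var_t'"
proof (rule fps_ext)
  fix n
  consider "n = 0" | "n = 1" | k where "n = Suc (Suc k)"
    by (metis One_nat_def not0_implies_Suc)
  thus "fps_nth (gf_tt' (\<lambda>m. scalar (if m \<le> 1 then 1 else 0))) n = fps_nth (1 + var_t * var_t') n"
    by cases (simp_all add: gf_tt'_def var_t_def var_t'_def)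
qed

section \<open>Degrees of the operators\<close>

lemma app_image_V_comp:
  fixes f :: "(tree, 'a::field) endo"
  assumes "\<And>T. int (num_nodes T) = j \<Longrightarrow> app f (Poly_Mapping.single T 1) \<in> V_comp k"
  shows "app f ` V_comp j \<subseteq> V_comp k"
proof clarify
  fix v :: "tree \<Rightarrow>\<^sub>0 'a" assume "v \<in> V_comp j"
  thus "app f v \<in> V_comp k"
    unfolding V_comp_def
  proof (induction v rule: free_vs.span_induct_alt)
    case (step c x y)
    thus ?case using assms
      by (auto simp: app_add app_scale V_comp_def
          intro!: free_vs.span_add free_vs.span_scale)
  qed (simp add: free_vs.span_zero)
qed

lemma single_in_V_comp: "int (num_nodes T) = j \<Longrightarrow> Poly_Mapping.single T 1 \<in> V_comp j"
  unfolding V_comp_def by (rule free_vs.span_base) blast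

lemma U'_op_V_comp: "app (U'_op i) ` V_comp j \<subseteq> V_comp (j + int i)"
proof (rule app_image_V_comp)
  fix T assume T: "int (num_nodes T) = j"
  show "app (U'_op i) (Poly_Mapping.single T 1) \<in> V_comp (j + int i)"
    unfolding U'_op_basis V_comp_def
    by (rule free_vs.span_sum, fold V_comp_def, rule single_in_V_comp)
      (use T in \<open>auto simp: G_U'_i_def\<close>)
qed

lemma D_op_V_comp: "app (D_op i) ` V_comp j \<subseteq> V_comp (j - int i)"
proof (rule app_image_V_comp)
  fix T assume T: "int (num_nodes T) = j"
  have "int (num_nodes (ominus T i)) = j - int i" if "i \<le> card (r_set T)"
    using num_nodes_ominus[OF that] T by linarith
  thus "app (D_op i) (Poly_Mapping.single T 1) \<in> V_comp (j - int i)"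
    by (auto simp: D_op_basis intro: single_in_V_comp)
      (simp add: V_comp_def free_vs.span_zero)
qed

theorem theorem4p2:
  shows "gf_t (D_op :: nat \<Rightarrow> (tree, 'k::field_char_0) endo) * gf_t' U'_op
           = (1 + var_t * var_t') * gf_t' U'_op * gf_t D_op
       \<and> generalized_Schur (D_op :: nat \<Rightarrow> (tree, 'k) endo) U'_op (\<lambda>m. if m \<le> 1 then 1 else 0)"
proof
  show "gf_t (D_op :: nat \<Rightarrow> (tree, 'k) endo) * gf_t' U'_op
      = (1 + var_t * var_t') * gf_t' U'_op * gf_t D_op"
  proof (intro fps_ext)
    fix n m
    show "fps_nth (fps_nth (gf_t (D_op :: nat \<Rightarrow> (tree, 'k) endo) * gf_t' U'_op) n) m =
        fps_nth (fps_nth ((1 + var_t * var_t') * gf_t' U'_op * gf_t D_op) n) m"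
      unfolding one_plus_var_t_var_t'_mult fps_add_nth fps_nth_var_t_var_t'_mult
        fps_nth_gf_t_gf_t' fps_nth_gf_t'_gf_t
      by (cases n; cases m) (simp_all add: D_op_U'_op)
  qed
  \<comment> \<open>Here \<open>t\<close> and \<open>t'\<close> are interchanged. As
    \<open>t t'\<close> is symmetric, the same relation between coefficients suffices.\<close>
  have "gf_t' D_op * gf_t U'_op =
      gf_tt' (\<lambda>m. scalar (if m \<le> 1 then 1 else 0 :: 'k)) * gf_t U'_op * gf_t' D_op"
  proof (intro fps_ext)
    fix n m
    show "fps_nth (fps_nth (gf_t' (D_op :: nat \<Rightarrow> (tree, 'k) endo) * gf_t U'_op) n) m =
        fps_nth (fps_nth (gf_tt' (\<lambda>m. scalar (if m \<le> 1 then 1 else 0)) * gf_t U'_op * gf_t' D_op) n) m"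
      unfolding gf_tt'_scalar one_plus_var_t_var_t'_mult fps_add_nth fps_nth_var_t_var_t'_mult
        fps_nth_gf_t_gf_t' fps_nth_gf_t'_gf_t
      by (cases n; cases m) (simp_all add: D_op_U'_op)
  qed
  thus "generalized_Schur (D_op :: nat \<Rightarrow> (tree, 'k) endo) U'_op (\<lambda>m. if m \<le> 1 then 1 else 0)"
    by (simp add: generalized_Schur_def U'_op_V_comp D_op_V_comp)
qed

end
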